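(* For the distribution $\mathcal D=\operatorname{span}\{X,Y\}$ on $AdS$ there are horizontal geodesics $c(s)$ (with nonvanishing Lagrange multiplier, $\lambda(s)\neq0$) with the following properties: 1. the length $|\dot c|$ of the velocity vector is constant along the geodesic; 2. the angles between the velocity vector and the horizontal frame are given by $$\angle(\dot c,X)=ks+\theta_0,\qquad \angle(\dot c,Y)=\frac{\pi}{2}-(ks+\theta_0),$$ for some real constants $k$ and $\theta_0$.
   Context: $\mathbb R^{2,2}$ is $\mathbb R^4$ with $\langle x,y\rangle=-x_1y_1-x_2y_2+x_3y_3+x_4y_4$, and $AdS=\{x\in\mathbb R^4:\langle x,x\rangle=-1\}$. The vector fields $T(x)=(-x_2,x_1,x_4,-x_3)$, $X(x)=(x_3,x_4,x_1,x_2)$, $Y(x)=(x_4,-x_3,-x_2,x_1)$ form an orthogonal basis of each tangent space of $AdS$ with $\langle T,T\rangle=-1$, $\langle X,X\rangle=\langle Y,Y\rangle=1$. A curve $c$ in $AdS$ is horizontal with respect to $\mathcal D=\operatorname{span}\{X,Y\}$ if $\dot c\in\operatorname{span}\{X,Y\}$, equivalently $\langle\dot c,T\rangle=0$. On $\mathcal D$ the form $\langle\cdot,\cdot\rangle$ is positive definite and defines $|\cdot|$. Angles are real-valued (signed, understood through their cosines): the formulas in item 2 mean $\langle\dot c,X\rangle=|\dot c|\cos(\angle(\dot c,X))$ and $\langle\dot c,Y\rangle=|\dot c|\cos(\angle(\dot c,Y))$. For a curve $c$ in $AdS$ put $\alpha=\langle\dot c,T(c)\rangle$, $\beta=\langle\dot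 c,X(c)\rangle$, $\gamma=\langle\dot c,Y(c)\rangle$. A geodesic here means a smooth, non-constant horizontal curve on $AdS$ which, for some function $\lambda(s)$ (the Lagrange multiplier), satisfies the Euler–Lagrange equations $\frac{d}{ds}\frac{\partial L}{\partial\dot c}=\frac{\partial L}{\partial c}$ on $AdS$ of the Lagrangian $L(c,\dot c)=\tfrac12(\beta^2+\gamma^2)+\lambda(s)\alpha$, i.e. an extremal of the action $\tfrac12\int_0^1(\beta^2+\gamma^2)\,ds$ under the constraint $\alpha=0$. *)

theory Defs
  imports "HOL-Analysis.Analysis"
begin

definition pform :: "real^4 \<Rightarrow> real^4 \<Rightarrow> real" where
  "pform x y = - x$1 * y$1 - x$2 * y$2 + x$3 * y$3 + x$4 * y$4"

definition AdS :: "(real^4) set" where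
  "AdS = {x. pform x x = -1}"

text \<open>Only meaningful for \<open>x\<close> in \<open>AdS\<close>: the kernel of the differential of \<open>pform x x\<close>.\<close>

definition AdS_tangent :: "real^4 \<Rightarrow> (real^4) set" where
  "AdS_tangent x = {w. pform x w = 0}"

definition T_field :: "real^4 \<Rightarrow> real^4" where
  "T_field x = vector [- x$2, x$1, x$4, - x$3]"

definition X_field :: "real^4 \<Rightarrow> real^4" where
  "X_field x = vector [x$3, x$4, x$1, x$2]"

definition Y_field :: "real^4 \<Rightarrow> real^4" where
  "Y_field x = vector [x$4, - x$3, - x$2, x$1]"

text \<open>The length \<open>\<bar>v\<bar>\<close> of a horizontal vector; \<open>pform\<close> is positive definite on the distribution.\<close>

definition hlen :: "real^4 \<Rightarrow> real" where
  "hlen v = sqrt (pform v v)"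

text \<open>Curves are parametrized by \<open>[0, 1]\<close>, the interval of the action integral;
  derivatives at the end points are one-sided. Values outside \<open>[0, 1]\<close> are irrelevant.\<close>

definition velocity :: "(real \<Rightarrow> real^4) \<Rightarrow> real \<Rightarrow> real^4" where
  "velocity c s = vector_derivative c (at s within {0..1})"

text \<open>\<open>D n\<close> is the \<open>n\<close>-th derivative of \<open>c\<close>.\<close>

definition smooth_curve :: "(real \<Rightarrow> real^4) \<Rightarrow> bool" where
  "smooth_curve c \<longleftrightarrow>
     (\<exists>D :: nat \<Rightarrow> real \<Rightarrow> real^4. D 0 = c \<and>
        (\<forall>n. \<forall>s\<in>{0..1}. (D n has_vector_derivative D (Suc n) s) (at s within {0..1})))"

definition horizontal :: "(real \<Rightarrow> real^4) \<Rightarrow> bool" where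
  "horizontal c \<longleftrightarrow> (\<forall>s\<in>{0..1}. velocity c s \<in> span {X_field (c s), Y_field (c s)})"

definition sr_lagrangian :: "(real \<Rightarrow> real) \<Rightarrow> real \<Rightarrow> real^4 \<Rightarrow> real^4 \<Rightarrow> real" where
  "sr_lagrangian lam s x v =
     ((pform v (X_field x))\<^sup>2 + (pform v (Y_field x))\<^sup>2) / 2 + lam s * pform v (T_field x)"

text \<open>The Euler-Lagrange equations on the submanifold \<open>AdS\<close> of a Lagrangian \<open>L s x v\<close> given on
  the ambient space: the covector \<open>d/ds (\<partial>L/\<partial>v) - \<partial>L/\<partial>x\<close> along \<open>c\<close> vanishes on all tangent
  vectors of \<open>AdS\<close>, i.e. only variations staying in \<open>AdS\<close> are admitted. For curves in \<open>AdS\<close> this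
  depends only on the restriction of \<open>L\<close> to the tangent bundle of \<open>AdS\<close>. The vectors \<open>p s\<close> and
  \<open>q s\<close> are the coordinate partial derivatives \<open>\<partial>L/\<partial>v\<close> and \<open>\<partial>L/\<partial>x\<close>, so they pair with tangent
  vectors through the standard inner product, not through \<open>pform\<close>.\<close>

definition euler_lagrange_on_AdS ::
    "(real \<Rightarrow> real^4 \<Rightarrow> real^4 \<Rightarrow> real) \<Rightarrow> (real \<Rightarrow> real^4) \<Rightarrow> bool" where
  "euler_lagrange_on_AdS L c \<longleftrightarrow>
     (\<exists>p q p' :: real \<Rightarrow> real^4. \<forall>s\<in>{0..1}.
        GDERIV (\<lambda>v. L s (c s) v) (velocity c s) :> p s \<and>
        GDERIV (\<lambda>x. L s x (velocity c s)) (c s) :> q s \<and>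
        (p has_vector_derivative p' s) (at s within {0..1}) \<and>
        (\<forall>w\<in>AdS_tangent (c s). p' s \<bullet> w = q s \<bullet> w))"

definition horizontal_geodesic :: "(real \<Rightarrow> real^4) \<Rightarrow> (real \<Rightarrow> real) \<Rightarrow> bool" where
  "horizontal_geodesic c lam \<longleftrightarrow>
     smooth_curve c \<and>
     (\<forall>s\<in>{0..1}. c s \<in> AdS) \<and>
     \<not> c constant_on {0..1} \<and>
     horizontal c \<and>
     euler_lagrange_on_AdS (sr_lagrangian lam) c"

end

theory Submission
  imports Defs
begin

text \<open>Write a point of \<open>AdS\<close> as \<open>(z, w)\<close> with \<open>z = x\<^sub>1 + \<i> x\<^sub>2\<close>, \<open>w = x\<^sub>3 + \<i> x\<^sub>4\<close>. A horizontal curve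
  with speed \<open>r\<close> and angle \<open>\<theta>\<close> solves \<open>z' = r e\<^bsup>-\<i>\<theta>\<^esup> w\<close>, \<open>w' = r e\<^bsup>\<i>\<theta>\<^esup> z\<close>. For \<open>\<theta> = k s + \<pi>/2\<close> this has the
  helical solutions \<open>z = A e\<^bsup>-\<i>ms\<^esup>\<close>, \<open>w = B e\<^bsup>\<i>ns\<^esup>\<close> with \<open>m + n = k\<close>, \<open>m n = r\<^sup>2\<close>, \<open>A m = B r\<close> and
  \<open>A\<^sup>2 - B\<^sup>2 = 1\<close>, and these satisfy the Euler-Lagrange equations with the constant multiplier
  \<open>k / 2\<close>. The values \<open>m = 9\<close>, \<open>n = 25\<close>, \<open>r = 15\<close>, \<open>A = 5/4\<close>, \<open>B = 3/4\<close> are rational.\<close>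

lemma vector_4 [simp]:
  "(vector [a, b, c, d] :: 'a::zero^4) $ 1 = a"
  "(vector [a, b, c, d] :: 'a::zero^4) $ 2 = b"
  "(vector [a, b, c, d] :: 'a::zero^4) $ 3 = c"
  "(vector [a, b, c, d] :: 'a::zero^4) $ 4 = d"
  unfolding vector_def by simp_all

lemma vec_eq_4_iff: "x = y \<longleftrightarrow> x$1 = y$1 \<and> x$2 = y$2 \<and> x$3 = y$3 \<and> x$4 = (y$4 :: 'a)"
  for x y :: "'a^4"
  by (simp add: vec_eq_iff forall_4)

lemma inner_vec_4: "x \<bullet> y = x$1 * y$1 + x$2 * y$2 + x$3 * y$3 + x$4 * y$4"
  for x y :: "real^4"
  by (simp add: inner_vec_def sum_4)

lemma has_vector_derivative_vector_4:
  fixes f1 f2 f3 f4 :: "real \<Rightarrow> real"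
  assumes "(f1 has_real_derivative d1) (at s within S)"
    and "(f2 has_real_derivative d2) (at s within S)"
    and "(f3 has_real_derivative d3) (at s within S)"
    and "(f4 has_real_derivative d4) (at s within S)"
  shows "((\<lambda>s. vector [f1 s, f2 s, f3 s, f4 s] :: real^4) has_vector_derivative
           vector [d1, d2, d3, d4]) (at s within S)"
proof -
  have sum: "vector [a, b, c, d] = a *\<^sub>R axis 1 1 + b *\<^sub>R axis 2 1 + c *\<^sub>R axis 3 1 + d *\<^sub>R (axis 4 1 :: real^4)"
    for a b c d :: real
    by (simp add: vec_eq_4_iff axis_def)
  show ?thesis
    unfolding sum
    by (rule derivative_eq_intros assms refl)+ simp
qed

text \<open>The pairings of \<open>v\<close> with the three frame fields are linear in
  \<open>v\<close>, and the vectors here are their coefficient vectors; the chain rule on the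
  squares gives the scalar factors.\<close>

lemma GDERIV_sr_lagrangian_velocity:
  "GDERIV (\<lambda>v. sr_lagrangian lam s x v) v :>
     pform v (X_field x) *\<^sub>R vector [- x$3, - x$4, x$1, x$2]
     + pform v (Y_field x) *\<^sub>R vector [- x$4, x$3, - x$2, x$1]
     + lam s *\<^sub>R vector [x$2, - x$1, x$4, - x$3]"
  unfolding gderiv_def sr_lagrangian_def pform_def X_field_def Y_field_def T_field_def
  by (auto intro!: derivative_eq_intros bounded_linear_imp_has_derivative bounded_linear_vec_nth ext
      simp: inner_vec_4 field_simps)

text \<open>Each pairing is bilinear and antisymmetric in \<open>x\<close> and \<open>v\<close>, so
  these vectors are minus those of the velocity gradient with \<open>v\<close> in place of
  \<open>x\<close>.\<close>

lemma GDERIV_sr_lagrangian_position: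
  "GDERIV (\<lambda>x. sr_lagrangian lam s x v) x :>
     pform v (X_field x) *\<^sub>R vector [v$3, v$4, - v$1, - v$2]
     + pform v (Y_field x) *\<^sub>R vector [v$4, - v$3, v$2, - v$1]
     + lam s *\<^sub>R vector [- v$2, v$1, - v$4, v$3]"
  unfolding gderiv_def sr_lagrangian_def pform_def X_field_def Y_field_def T_field_def
  by (auto intro!: derivative_eq_intros bounded_linear_imp_has_derivative bounded_linear_vec_nth ext
      simp: inner_vec_4 field_simps)

definition helix :: "real \<Rightarrow> real^4" where
  "helix s = vector [5/4 * cos (9 * s), - (5/4 * sin (9 * s)), 3/4 * cos (25 * s), 3/4 * sin (25 * s)]"

text \<open>Each derivative multiplies by the frequency and advances the phase by a quarter turn, so
  one formula covers all orders and serves as the witness in \<open>smooth_curve\<close>.\<close>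

definition helix_deriv :: "nat \<Rightarrow> real \<Rightarrow> real^4" where
  "helix_deriv n s = vector
     [5/4 * 9^n * cos (9 * s + n * pi / 2), - (5/4 * 9^n * sin (9 * s + n * pi / 2)),
      3/4 * 25^n * cos (25 * s + n * pi / 2), 3/4 * 25^n * sin (25 * s + n * pi / 2)]"

text \<open>The factor \<open>1 + real n\<close> is the form into which simp brings
  \<open>real (Suc n)\<close>.\<close>

lemma quarter_turn:
  "cos (x + (1 + real n) * pi / 2) = - sin (x + real n * pi / 2)"
  "sin (x + (1 + real n) * pi / 2) = cos (x + real n * pi / 2)"
proof -
  have eq: "x + (1 + real n) * pi / 2 = (x + real n * pi / 2) + pi / 2"
    by (simp add: field_simps)
  have "cos (y + pi / 2) = - sin y" "sin (y + pi / 2) = cos y" for y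
    by (simp_all add: cos_add sin_add)
  then show "cos (x + (1 + real n) * pi / 2) = - sin (x + real n * pi / 2)"
    "sin (x + (1 + real n) * pi / 2) = cos (x + real n * pi / 2)"
    unfolding eq by blast+
qed

lemma has_vector_derivative_helix_deriv:
  "(helix_deriv n has_vector_derivative helix_deriv (Suc n) s) (at s within S)"
proof -
  have "helix_deriv n = (\<lambda>s. vector
     [5/4 * 9^n * cos (9 * s + n * pi / 2), - (5/4 * 9^n * sin (9 * s + n * pi / 2)),
      3/4 * 25^n * cos (25 * s + n * pi / 2), 3/4 * 25^n * sin (25 * s + n * pi / 2)])"
    by (simp add: fun_eq_iff helix_deriv_def)
  then show ?thesis
    unfolding helix_deriv_def[of "Suc n"]
    by (simp only:)
      (rule has_vector_derivative_vector_4;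
       auto intro!: derivative_eq_intros simp: quarter_turn)
qed

lemma helix_deriv_0: "helix_deriv 0 = helix"
  by (simp add: fun_eq_iff helix_deriv_def helix_def)

lemma smooth_curve_helix: "smooth_curve helix"
  unfolding smooth_curve_def
  using helix_deriv_0 has_vector_derivative_helix_deriv by blast

lemma velocity_helix:
  assumes "s \<in> {0..1}"
  shows "velocity helix s = vector [- (45/4 * sin (9 * s)), - (45/4 * cos (9 * s)),
    - (75/4 * sin (25 * s)), 75/4 * cos (25 * s)]"
proof -
  have "(helix has_vector_derivative helix_deriv (Suc 0) s) (at s within {0..1})"
    by (metis helix_deriv_0 has_vector_derivative_helix_deriv)
  then have "velocity helix s = helix_deriv (Suc 0) s"
    using assms unfolding velocity_def
    by (intro vector_derivative_within_closed_interval) auto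
  then show ?thesis
    by (simp add: helix_deriv_def cos_add sin_add)
qed

lemma helix_in_AdS: "helix s \<in> AdS"
proof -
  have "pform (helix s) (helix s) =
      9/16 * ((sin (25 * s))\<^sup>2 + (cos (25 * s))\<^sup>2) - 25/16 * ((sin (9 * s))\<^sup>2 + (cos (9 * s))\<^sup>2)"
    by (simp add: pform_def helix_def power2_eq_square algebra_simps
        del: sin_cos_squared_add sin_cos_squared_add2 sin_cos_squared_add3)
  then show ?thesis
    by (simp add: AdS_def)
qed

lemma hlen_velocity_helix:
  assumes "s \<in> {0..1}"
  shows "hlen (velocity helix s) = 15"
proof -
  have "pform (velocity helix s) (velocity helix s) =
      5625/16 * ((sin (25 * s))\<^sup>2 + (cos (25 * s))\<^sup>2) - 2025/16 * ((sin (9 * s))\<^sup>2 + (cos (9 * s))\<^sup>2)"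
    by (simp add: pform_def velocity_helix[OF assms] power2_eq_square algebra_simps
        del: sin_cos_squared_add sin_cos_squared_add2 sin_cos_squared_add3)
  then have "pform (velocity helix s) (velocity helix s) = 15\<^sup>2"
    by simp
  then show ?thesis
    by (simp add: hlen_def)
qed

text \<open>The addition formulas merge the frequencies 9 and 25 into their sum 34; the amplitude is
  \<open>75/4 * 5/4 - 45/4 * 3/4 = 15\<close>.\<close>

lemma pform_velocity_helix:
  assumes "s \<in> {0..1}"
  shows "pform (velocity helix s) (X_field (helix s)) = - 15 * sin (34 * s)"
    and "pform (velocity helix s) (Y_field (helix s)) = 15 * cos (34 * s)"
  using sin_add[of "9 * s" "25 * s"] cos_add[of "9 * s" "25 * s"]
  by (simp_all add: pform_def velocity_helix[OF assms] X_field_def Y_field_def helix_def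
      field_simps)

text \<open>Taking one frequency off the sum 34 leaves the other. This turns products of frame
  coefficients with coordinates back into single frequencies.\<close>

lemma rotate_34:
  "sin (34 * s) * cos (9 * s) - cos (34 * s) * sin (9 * s) = sin (25 * s)"
  "cos (34 * s) * cos (9 * s) + sin (34 * s) * sin (9 * s) = cos (25 * s)"
  "sin (34 * s) * cos (25 * s) - cos (34 * s) * sin (25 * s) = sin (9 * s)"
  "cos (34 * s) * cos (25 * s) + sin (34 * s) * sin (25 * s) = cos (9 * s)"
  for s :: real
  using sin_diff[of "34 * s" "9 * s"] cos_diff[of "34 * s" "9 * s"]
    sin_diff[of "34 * s" "25 * s"] cos_diff[of "34 * s" "25 * s"]
  by simp_all

lemma horizontal_helix: "horizontal helix"
  unfolding horizontal_def
proof
  fix s :: real assume s: "s \<in> {0..1}"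
  \<comment> \<open>The coefficients are the pairings with \<open>X_field\<close> and
    \<open>Y_field\<close>, as for any horizontal vector in this orthonormal frame.\<close>
  have "velocity helix s = (- 15 * sin (34 * s)) *\<^sub>R X_field (helix s) + (15 * cos (34 * s)) *\<^sub>R Y_field (helix s)"
    using rotate_34[of s]
    by (simp add: vec_eq_4_iff velocity_helix[OF s] X_field_def Y_field_def helix_def algebra_simps)
  then show "velocity helix s \<in> span {X_field (helix s), Y_field (helix s)}"
    by (simp add: span_add span_base span_diff span_scale span_neg)
qed

lemma helix_not_constant: "\<not> helix constant_on {0..1}"
proof
  assume "helix constant_on {0..1}"
  then obtain a where "\<And>s. s \<in> {0..1} \<Longrightarrow> helix s = a"
    unfolding constant_on_def by blast
  \<comment> \<open>At \<open>pi/50\<close> the phase \<open>25 * s\<close> is \<open>pi/2\<close>,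
    so the third coordinate has dropped from 3/4 to 0.\<close>
  then have "helix (pi/50) = helix 0"
    using pi_less_4 by simp
  then have "helix (pi/50) $ 3 = helix 0 $ 3"
    by simp
  then show False
    by (simp add: helix_def)
qed

lemma euler_lagrange_helix: "euler_lagrange_on_AdS (sr_lagrangian (\<lambda>_. 17)) helix"
proof -
  define p :: "real \<Rightarrow> real^4" where
    "p s = vector [- (10 * sin (9 * s)), - (10 * cos (9 * s)), - (6 * sin (25 * s)), 6 * cos (25 * s)]" for s
  define p' :: "real \<Rightarrow> real^4" where
    "p' s = vector [- (90 * cos (9 * s)), 90 * sin (9 * s), - (150 * cos (25 * s)), - (150 * sin (25 * s))]" for s
  \<comment> \<open>Here \<open>378 = 15^2 + 17 * 9\<close> and \<open>650 = 15^2 + 17 * 25\<close>: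
    the squared speed plus the multiplier times a frequency.\<close>
  define q :: "real \<Rightarrow> real^4" where
    "q s = vector [378 * helix s $ 1, 378 * helix s $ 2, - (650 * helix s $ 3), - (650 * helix s $ 4)]" for s
  show ?thesis
    unfolding euler_lagrange_on_AdS_def
  proof (intro exI ballI conjI)
    fix s :: real assume s: "s \<in> {0..1}"
    let ?x = "helix s" and ?v = "velocity helix s"
    have "pform ?v (X_field ?x) *\<^sub>R vector [- ?x$3, - ?x$4, ?x$1, ?x$2]
        + pform ?v (Y_field ?x) *\<^sub>R vector [- ?x$4, ?x$3, - ?x$2, ?x$1]
        + 17 *\<^sub>R vector [?x$2, - ?x$1, ?x$4, - ?x$3] = p s"
      unfolding pform_velocity_helix[OF s]
      using rotate_34[of s]
      by (simp add: vec_eq_4_iff helix_def p_def algebra_simps)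
    then show "GDERIV (\<lambda>v. sr_lagrangian (\<lambda>_. 17) s ?x v) ?v :> p s"
      using GDERIV_sr_lagrangian_velocity[of "\<lambda>_. 17" s ?x ?v] by simp
    have "pform ?v (X_field ?x) *\<^sub>R vector [?v$3, ?v$4, - ?v$1, - ?v$2]
        + pform ?v (Y_field ?x) *\<^sub>R vector [?v$4, - ?v$3, ?v$2, - ?v$1]
        + 17 *\<^sub>R vector [- ?v$2, ?v$1, - ?v$4, ?v$3] = q s"
      unfolding pform_velocity_helix[OF s]
      using rotate_34[of s]
      by (simp add: velocity_helix[OF s] vec_eq_4_iff helix_def q_def
          algebra_simps)
    then show "GDERIV (\<lambda>x. sr_lagrangian (\<lambda>_. 17) s x ?v) ?x :> q s"
      using GDERIV_sr_lagrangian_position[of "\<lambda>_. 17" s ?v ?x] by simp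
    show "(p has_vector_derivative p' s) (at s within {0..1})"
      unfolding p_def p'_def
      by (rule has_vector_derivative_vector_4; auto intro!: derivative_eq_intros)
    fix w assume w: "w \<in> AdS_tangent ?x"
    \<comment> \<open>The Euler-Lagrange covector is not zero in the ambient space but a multiple of
      the conormal of \<open>AdS\<close>, hence zero on tangent vectors.\<close>
    have "p' s \<bullet> w - q s \<bullet> w = 450 * pform ?x w"
      by (simp add: inner_vec_4 p'_def q_def helix_def pform_def algebra_simps)
    with w show "p' s \<bullet> w = q s \<bullet> w"
      by (simp add: AdS_tangent_def)
  qed
qed

theorem theorem10:
  shows "\<exists>(c :: real \<Rightarrow> real^4) (lam :: real \<Rightarrow> real).
     horizontal_geodesic c lam \<and> (\<forall>s\<in>{0..1}. lam s \<noteq> 0) \<and>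
     (\<lambda>s. hlen (velocity c s)) constant_on {0..1} \<and>
     (\<exists>k \<theta>\<^sub>0 :: real. \<forall>s\<in>{0..1}.
        pform (velocity c s) (X_field (c s)) =
          hlen (velocity c s) * cos (k * s + \<theta>\<^sub>0) \<and>
        pform (velocity c s) (Y_field (c s)) =
          hlen (velocity c s) * cos (pi / 2 - (k * s + \<theta>\<^sub>0)))"
proof (intro exI conjI ballI)
  show "horizontal_geodesic helix (\<lambda>_. 17)"
    unfolding horizontal_geodesic_def
    using smooth_curve_helix helix_in_AdS helix_not_constant horizontal_helix euler_lagrange_helix
    by blast
  show "(17::real) \<noteq> 0"
    by simp
  show "(\<lambda>s. hlen (velocity helix s)) constant_on {0..1}"
    unfolding constant_on_def using hlen_velocity_helix by blast
next
  fix s :: real assume s: "s \<in> {0..1}"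
  \<comment> \<open>The witnesses are \<open>k = 9 + 25\<close> and
    \<open>\<theta>\<^sub>0 = pi/2\<close>; this phase turns the two cosines into
    \<open>- sin (34 * s)\<close> and \<open>cos (34 * s)\<close>.\<close>
  show "pform (velocity helix s) (X_field (helix s)) = hlen (velocity helix s) * cos (34 * s + pi/2)"
    by (simp add: pform_velocity_helix[OF s] hlen_velocity_helix[OF s] cos_add)
  show "pform (velocity helix s) (Y_field (helix s)) =
      hlen (velocity helix s) * cos (pi / 2 - (34 * s + pi/2))"
    by (simp add: pform_velocity_helix[OF s] hlen_velocity_helix[OF s])
qed

end
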